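(* Let $f$ be a polynomial of degree two with integer coefficients which maps $\mathbf N$ to $\mathbf N$ and is strictly increasing on $\mathbf N$. Then for every (arbitrarily large) $J>0$, $$\liminf_{Q\to\infty}\frac{(\log f(Q))^J\,Qf(Q)}{\mathscr N_f(Q,Qf(Q))}=0 .$$
   Context: $\mathbf N=\{1,2,3,\dots\}$; sums run over natural numbers; $(a,b)$ is the greatest common divisor; $e(x)=\exp(2\pi i x)$. For $Q,N\geq3$, $$\mathscr N_f(Q,N)=\sup_{(z_n)_n\in\mathscr C_N}\ \sum_{q\leq Q}\ \sum_{\substack{a\leq f(q)\\ (a,f(q))=1}}\Big|\sum_{n\leq N}z_n\,e\Big(\frac{an}{f(q)}\Big)\Big|^2,$$ where $\mathscr C_N$ is the set of sequences $(z_n)_n$ of complex numbers with $\sum_{n\leq N}|z_n|^2=1$. *)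

theory Defs
  imports "HOL-Analysis.Analysis" "HOL-Computational_Algebra.Polynomial"
begin

definition e :: "real \<Rightarrow> complex" where
  "e x = exp (2 * of_real pi * \<i> * of_real x)"

(* Only z 1, ..., z N matter: the values of z at 0 and beyond N are unconstrained and unused. *)
definition unit_seqs :: "nat \<Rightarrow> (nat \<Rightarrow> complex) set" where
  "unit_seqs N = {z. (\<Sum>n=1..N. (cmod (z n))\<^sup>2) = 1}"

definition sieve_sum :: "int poly \<Rightarrow> nat \<Rightarrow> nat \<Rightarrow> (nat \<Rightarrow> complex) \<Rightarrow> real" where
  "sieve_sum f Q N z =
     (\<Sum>q=1..Q. \<Sum>a | 1 \<le> a \<and> a \<le> poly f (int q) \<and> coprime a (poly f (int q)).
        (cmod (\<Sum>n=1..N. z n * e (of_int a * of_nat n / of_int (poly f (int q)))))\<^sup>2)"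

definition sieve_norm :: "int poly \<Rightarrow> nat \<Rightarrow> nat \<Rightarrow> real" where
  "sieve_norm f Q N = (SUP z\<in>unit_seqs N. sieve_sum f Q N z)"

(* The two facts below show that the supremum of reals in sieve_norm is a genuine one. *)
lemma unit_seqs_nonempty: "N \<ge> 1 \<Longrightarrow> unit_seqs N \<noteq> {}"
proof -
  assume N: "N \<ge> 1"
  have "(\<Sum>n=1..N. (cmod (if n = 1 then 1 else 0))\<^sup>2) = (\<Sum>n=1..N. if n = 1 then 1 else (0::real))"
    by (intro sum.cong) auto
  also have "\<dots> = 1" using N by simp
  finally have "(\<lambda>n. if n = 1 then 1 else 0) \<in> unit_seqs N"
    by (simp add: unit_seqs_def)
  thus ?thesis by blast
qed

lemma bdd_above_sieve_sum: "bdd_above (sieve_sum f Q N ` unit_seqs N)"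
proof (rule bdd_aboveI2)
  fix z assume z: "z \<in> unit_seqs N"
  have le1: "cmod (z n) \<le> 1" if n: "n \<in> {1..N}" for n
  proof -
    have "(cmod (z n))\<^sup>2 \<le> (\<Sum>n=1..N. (cmod (z n))\<^sup>2)"
      by (rule member_le_sum) (use n in auto)
    also have "\<dots> = 1\<^sup>2" using z by (simp add: unit_seqs_def)
    finally show ?thesis by (rule power2_le_imp_le) simp
  qed
  have ne: "cmod (e x) = 1" for x by (simp add: e_def)
  have inner: "cmod (\<Sum>n=1..N. z n * e (w n)) \<le> real N" for w
  proof -
    have "cmod (\<Sum>n=1..N. z n * e (w n)) \<le> of_nat (card {1..N}) * (1::real)"
      by (rule sum_norm_bound) (use le1 in \<open>simp add: norm_mult ne\<close>)
    thus ?thesis by simp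
  qed
  show "sieve_sum f Q N z \<le>
     (\<Sum>q=1..Q. \<Sum>a | 1 \<le> a \<and> a \<le> poly f (int q) \<and> coprime a (poly f (int q)). (real N)\<^sup>2)"
    unfolding sieve_sum_def by (intro sum_mono power_mono inner norm_ge_zero)
qed

end

theory Submission
  imports Defs "HOL-Number_Theory.Cong" "HOL-Real_Asymp.Real_Asymp"
begin

text \<open>
  There are at most \<open>Q * f Q\<close> reduced fractions in \<open>(0, 1]\<close> with denominators \<open>f q\<close>, \<open>q \<le> Q\<close>, so
  with \<open>N = Q * f Q\<close> an interval of length \<open>1 / (3 * N)\<close> contains boundedly many on average.
  The sieve constant is nevertheless at least a constant times \<open>N\<close> times the number of them in
  any single such interval, as one sees by testing with \<open>z n = e (- \<beta> * n) / sqrt N\<close>, where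
  \<open>\<beta>\<close> is the midpoint (\<open>sieve_norm_ge_cluster\<close>). So it suffices to find, for arbitrarily
  large \<open>Q\<close>, an interval with more than any given power of \<open>log (f Q)\<close> fractions.

  Such clusters come from a modulus \<open>B\<close> for which \<open>f\<close> takes one value \<open>r\<close>, prime to \<open>B\<close>,
  modulo \<open>B\<close> very often. Choose \<open>u\<close> with \<open>u * r \<equiv> - 1\<close> modulo \<open>B\<close>. Whenever \<open>f q \<equiv> r\<close> modulo
  \<open>B\<close>, the number \<open>a = (u * f q + 1) / B\<close> is an integer, it is prime to \<open>f q\<close> because
  \<open>a * B - u * f q = 1\<close>, and \<open>a / f q = u / B + 1 / (B * f q)\<close>. If moreover \<open>q \<le> Q \<le> B\<close> and
  \<open>f q\<close> differs from \<open>f Q\<close> by a factor of at most \<open>7 / 6\<close>, then all these fractions lie within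
  \<open>1 / (6 * N)\<close> of one another (\<open>sieve_norm_ge_card_cong\<close>). The condition on the ratios costs only a
  factor \<open>O(log (f B))\<close>, by the pigeonhole principle on a logarithmic scale
  (\<open>log_pigeonhole\<close>).

  It remains to find \<open>B\<close>. If \<open>f = A x^2 + b x + c\<close>, then
  \<open>f x - f x0 = (x - x0) * (A * (x + x0) + b)\<close>, so modulo each number prime to
  \<open>A * (2 * A * x0 + b)\<close> the value \<open>f x0\<close> is taken at two different residues. A product \<open>B\<close> of \<open>k\<close>
  pairwise coprime moduli of this kind gives \<open>2 ^ k\<close> solutions in \<open>[1, B]\<close>
  (\<open>card_quadratic_cong_ge\<close>). With the moduli \<open>1 + i * k! * M\<close>, \<open>i \<le> k\<close>, the logarithm of \<open>B\<close> is
  only polynomial in \<open>k\<close> (\<open>quadratic_rich_value_class\<close>), so \<open>2 ^ k\<close> exceeds every power of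
  \<open>log (f B)\<close>. Here \<open>x0 = 2\<close> always works: monotonicity gives
  \<open>0 < f 3 - f 1 = 2 * (4 * A + b)\<close>, so that \<open>f' 2 \<noteq> 0\<close>, whereas \<open>f' 1\<close> may vanish.
\<close>

section \<open>Clusters of fractions\<close>

lemma e_add: "e (x + y) = e x * e y"
  by (simp add: e_def exp_add [symmetric] algebra_simps)

lemma cmod_e: "cmod (e x) = 1"
  by (simp add: e_def)

lemma Re_e: "Re (e x) = cos (2 * pi * x)"
  by (simp add: e_def Re_exp)

text \<open>
  All the phases \<open>\<theta> * n\<close> stay within \<open>1 / 6\<close> of \<open>0\<close>, so that every term has real part at least
  \<open>cos (\<pi> / 3) = 1 / 2\<close>. This is the source of the constant \<open>1 / 6\<close>, and so of the ratio \<open>7 / 6\<close>,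
  used below.
\<close>

lemma norm_sum_e_ge:
  fixes N :: nat and \<theta> :: real
  assumes "N * \<bar>\<theta>\<bar> \<le> 1 / 6"
  shows "real N / 2 \<le> cmod (\<Sum>n=1..N. e (\<theta> * n))"
proof -
  have "real N / 2 = (\<Sum>n=1..N. 1 / 2)" by simp
  also have "\<dots> \<le> (\<Sum>n=1..N. Re (e (\<theta> * n)))"
  proof (rule sum_mono)
    fix n assume n: "n \<in> {1..N}"
    have "\<bar>\<theta> * n\<bar> \<le> N * \<bar>\<theta>\<bar>"
      using n mult_left_mono [of "real n" "real N" "\<bar>\<theta>\<bar>"] by (simp add: abs_mult mult.commute)
    hence "\<bar>\<theta> * n\<bar> \<le> 1 / 6" using assms by linarith
    hence le: "\<bar>2 * pi * (\<theta> * n)\<bar> \<le> pi / 3" by (simp add: abs_mult field_simps)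
    have "cos (pi / 3) \<le> cos \<bar>2 * pi * (\<theta> * n)\<bar>"
      by (rule cos_monotone_0_pi_le [OF abs_ge_zero le]) simp
    thus "1 / 2 \<le> Re (e (\<theta> * n))" unfolding Re_e cos_abs_real by (simp add: cos_60)
  qed
  also have "\<dots> = Re (\<Sum>n=1..N. e (\<theta> * n))" by simp
  also have "\<dots> \<le> cmod (\<Sum>n=1..N. e (\<theta> * n))" by (rule complex_Re_le_cmod)
  finally show ?thesis .
qed

text \<open>
  A single additive character, normalised to be a unit sequence, correlates with every
  fraction close to its frequency: each such fraction contributes at least \<open>(N / 2)^2 / N\<close>.
\<close>

lemma sieve_norm_ge_cluster:
  assumes N: "N \<ge> 1" and S: "S \<subseteq> {1..Q}"
    and a: "\<And>q. q \<in> S \<Longrightarrow> 1 \<le> a q \<and> a q \<le> poly f (int q) \<and> coprime (a q) (poly f (int q))"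
    and near: "\<And>q. q \<in> S \<Longrightarrow> N * \<bar>of_int (a q) / of_int (poly f (int q)) - \<beta>\<bar> \<le> 1 / 6"
  shows "real (card S) * N / 4 \<le> sieve_norm f Q N"
proof -
  define z where "z n = e (- \<beta> * real n) / complex_of_real (sqrt N)" for n :: nat
  define A where "A q = {a. 1 \<le> a \<and> a \<le> poly f (int q) \<and> coprime a (poly f (int q))}" for q :: nat
  define g where "g q a = (cmod (\<Sum>n=1..N. z n * e (of_int a * of_nat n / of_int (poly f (int q)))))\<^sup>2"
    for q :: nat and a :: int
  have finA: "finite (A q)" for q
    by (rule finite_subset [of _ "{1..poly f (int q)}"]) (auto simp: A_def)
  have "(cmod (z n))\<^sup>2 = 1 / N" for n
    using N by (simp add: z_def norm_divide cmod_e power_divide)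
  hence "(\<Sum>n=1..N. (cmod (z n))\<^sup>2) = 1" using N by simp
  hence z: "z \<in> unit_seqs N" by (simp add: unit_seqs_def)
  have g_ge: "real N / 4 \<le> g q (a q)" if q: "q \<in> S" for q
  proof -
    define \<theta> where "\<theta> = of_int (a q) / of_int (poly f (int q)) - \<beta>"
    have "z n * e (of_int (a q) * of_nat n / of_int (poly f (int q))) = e (\<theta> * n) / complex_of_real (sqrt N)"
      for n :: nat
      unfolding z_def \<theta>_def times_divide_eq_left e_add [symmetric]
      by (simp add: algebra_simps)
    hence "g q (a q) = (cmod ((\<Sum>n=1..N. e (\<theta> * n)) / complex_of_real (sqrt N)))\<^sup>2"
      by (simp add: g_def sum_divide_distrib)
    also have "\<dots> = (cmod (\<Sum>n=1..N. e (\<theta> * n)))\<^sup>2 / N"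
      by (simp add: norm_divide power_divide)
    also have "\<dots> \<ge> (real N / 2)\<^sup>2 / N"
      using norm_sum_e_ge [OF near [OF q, folded \<theta>_def]] by (intro divide_right_mono power_mono) auto
    finally show ?thesis using N by (simp add: power2_eq_square)
  qed
  have "real (card S) * N / 4 = (\<Sum>q\<in>S. real N / 4)" by simp
  also have "\<dots> \<le> (\<Sum>q\<in>S. \<Sum>a\<in>A q. g q a)"
  proof (rule sum_mono)
    fix q assume q: "q \<in> S"
    have "g q (a q) \<le> (\<Sum>a\<in>A q. g q a)"
      by (rule member_le_sum) (use a [OF q] finA in \<open>auto simp: A_def g_def\<close>)
    thus "real N / 4 \<le> (\<Sum>a\<in>A q. g q a)" using g_ge [OF q] by linarith
  qed
  also have "\<dots> \<le> (\<Sum>q=1..Q. \<Sum>a\<in>A q. g q a)"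
    by (rule sum_mono2) (use S in \<open>auto intro!: sum_nonneg simp: g_def\<close>)
  also have "\<dots> = sieve_sum f Q N z"
    by (simp add: sieve_sum_def A_def g_def)
  also have "\<dots> \<le> sieve_norm f Q N"
    unfolding sieve_norm_def by (rule cSUP_upper [OF z bdd_above_sieve_sum])
  finally show ?thesis .
qed

lemma sieve_norm_nonneg:
  assumes "N \<ge> 1"
  shows "0 \<le> sieve_norm f Q N"
  using sieve_norm_ge_cluster [of N "{}" Q] assms by simp

text \<open>
  The numerators \<open>a q\<close> are chosen so that \<open>a q / f q - u / B = 1 / (B * f q)\<close>. The numerator \<open>1\<close> of
  this difference makes the fractions reduced; since \<open>Q \<le> B\<close>, the sizes \<open>1 / (B * f q)\<close> are
  at most about \<open>1 / (Q * f Q)\<close>, and the ratio condition makes them differ by a small multiple of it.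
\<close>

lemma sieve_norm_ge_card_cong:
  fixes f :: "int poly" and B Q :: nat and r :: int
  assumes S: "S \<subseteq> {1..Q}" and Q: "Q \<in> S" and QB: "Q \<le> B" and B: "B > 1"
    and r: "coprime r (int B)"
    and pos: "\<And>q. q \<in> S \<Longrightarrow> poly f (int q) \<ge> 1"
    and cong: "\<And>q. q \<in> S \<Longrightarrow> [poly f (int q) = r] (mod int B)"
    and le: "\<And>q. q \<in> S \<Longrightarrow> poly f (int q) \<le> poly f (int Q)"
    and ge: "\<And>q. q \<in> S \<Longrightarrow> 6 * poly f (int Q) \<le> 7 * poly f (int q)"
  shows "real (card S) * (of_nat Q * of_int (poly f (int Q))) / 4
           \<le> sieve_norm f Q (Q * nat (poly f (int Q)))"
proof -
  let ?F = "\<lambda>q::nat. poly f (int q)"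
  obtain v where v: "[r * v = 1] (mod int B)"
    using cong_solve_coprime_int [OF r] by auto
  \<comment> \<open>Taking \<open>u\<close> to be an inverse of \<open>- r\<close>, not of \<open>r\<close>, makes \<open>a q\<close> positive even when \<open>f q = 1\<close>;
    \<open>u < B\<close> gives \<open>a q \<le> f q\<close>.\<close>
  define u where "u = (- v) mod int B"
  have u: "0 \<le> u" "u \<le> int B - 1" using B by (auto simp: u_def)
  have "[r * u = r * (- v)] (mod int B)" unfolding u_def by (intro cong_mult) (auto simp: cong_def)
  also have "[r * (- v) = - 1] (mod int B)" using cong_minus_minus_iff v by fastforce
  finally have ru: "[r * u = - 1] (mod int B)" .
  define a where "a q = (u * ?F q + 1) div int B" for q :: nat
  have aB: "a q * int B = u * ?F q + 1" if q: "q \<in> S" for q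
  proof -
    have "[u * ?F q + 1 = u * r + 1] (mod int B)"
      using cong [OF q] by (intro cong_add cong_mult) auto
    also have "[u * r + 1 = - 1 + 1] (mod int B)"
      using ru by (intro cong_add) (auto simp: mult.commute)
    finally have "int B dvd u * ?F q + 1" by (simp add: cong_0_iff)
    thus ?thesis by (simp add: a_def)
  qed
  have a: "1 \<le> a q \<and> a q \<le> ?F q \<and> coprime (a q) (?F q)" if q: "q \<in> S" for q
  proof (intro conjI)
    have "a q * int B > 0" using aB [OF q] u(1) pos [OF q]
      by (simp add: add_nonneg_pos)
    thus "1 \<le> a q" by (simp add: zero_less_mult_iff)
    have "a q * int B \<le> (int B - 1) * ?F q + 1"
      unfolding aB [OF q] using u pos [OF q] by (intro add_right_mono mult_right_mono) auto
    also have "\<dots> \<le> ?F q * int B" using pos [OF q] by (simp add: algebra_simps)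
    finally show "a q \<le> ?F q" using B by simp
    show "coprime (a q) (?F q)"
    proof (rule coprimeI)
      fix d assume d: "d dvd a q" "d dvd ?F q"
      hence "d dvd a q * int B - u * ?F q" by (intro dvd_diff dvd_mult2 dvd_mult) 
      thus "is_unit d" using aB [OF q] by simp
    qed
  qed
  have frac: "of_int (a q) / of_int (?F q) = (of_int u / B + 1 / (B * of_int (?F q)) :: real)"
    if q: "q \<in> S" for q
  proof -
    have "of_int (a q) * real B = of_int u * of_int (?F q) + 1"
      using arg_cong [OF aB [OF q], of "of_int :: int \<Rightarrow> real"] by simp
    thus ?thesis using B pos [OF q] by (simp add: field_simps)
  qed
  have FQ: "?F Q \<ge> 1" using pos Q by auto
  have Q1: "Q \<ge> 1" using S Q by auto
  have N: "real (Q * nat (?F Q)) = of_nat Q * of_int (?F Q)" using FQ by simp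
  have N1: "Q * nat (?F Q) \<ge> 1" using Q1 FQ by simp
  have near: "real (Q * nat (?F Q)) * \<bar>of_int (a q) / of_int (?F q) - of_int (a Q) / of_int (?F Q)\<bar> \<le> 1 / 6"
    if q: "q \<in> S" for q
  proof -
    define x y :: real where "x = of_int (?F q)" and "y = of_int (?F Q)"
    have x: "x \<ge> 1" using pos [OF q] by (simp add: x_def)
    have xy: "x \<le> y" using le [OF q] by (simp add: x_def y_def)
    have yx: "6 * y \<le> 7 * x" using ge [OF q] unfolding x_def y_def by linarith
    have "of_int (a q) / of_int (?F q) - of_int (a Q) / of_int (?F Q) = 1 / (B * x) - 1 / (B * y)"
      unfolding frac [OF q] frac [OF Q] by (simp add: x_def y_def)
    also have "\<dots> = (y - x) / (B * x * y)" using x xy B by (simp add: field_simps)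
    finally have dist: "\<bar>of_int (a q) / of_int (?F q) - of_int (a Q) / of_int (?F Q)\<bar> = (y - x) / (B * x * y)"
      using x xy by simp
    have "real (Q * nat (?F Q)) * \<bar>of_int (a q) / of_int (?F q) - of_int (a Q) / of_int (?F Q)\<bar>
       = (Q * y) * ((y - x) / (B * x * y))"
      unfolding dist N y_def ..
    also have "\<dots> = (Q / B) * ((y - x) / x)" using x xy B by (simp add: field_simps)
    also have "\<dots> \<le> 1 * (1 / 6)"
      using QB B x xy yx by (intro mult_mono) (auto simp: field_simps)
    finally show ?thesis by simp
  qed
  show ?thesis
    using sieve_norm_ge_cluster [OF N1 S a near] unfolding N by simp
qed

section \<open>Many solutions of a quadratic congruence\<close>

text \<open>
  Modulo \<open>m i\<close> the congruence has the root \<open>x0\<close> and the root \<open>s\<close> of the linear factor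
  \<open>A * (x + x0) + b\<close>. They differ, since that factor is the unit \<open>2 * A * x0 + b\<close> at \<open>x0\<close>. The
  Chinese remainder theorem turns each subset \<open>T\<close> of the index set into a solution that is \<open>x0\<close>
  modulo \<open>m i\<close> exactly for \<open>i \<in> T\<close>.
\<close>

lemma card_quadratic_cong_ge:
  fixes A b c x0 :: int and m :: "'i \<Rightarrow> nat"
  assumes I: "finite I"
    and m: "\<And>i. i \<in> I \<Longrightarrow> m i > 1"
    and cop: "\<And>i j. i \<in> I \<Longrightarrow> j \<in> I \<Longrightarrow> i \<noteq> j \<Longrightarrow> coprime (m i) (m j)"
    and copA: "\<And>i. i \<in> I \<Longrightarrow> coprime A (int (m i))"
    and copD: "\<And>i. i \<in> I \<Longrightarrow> coprime (2 * A * x0 + b) (int (m i))"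
  defines "B \<equiv> \<Prod>i\<in>I. m i"
  shows "2 ^ card I \<le> card {x \<in> {1..B}. [poly [:c, b, A:] (int x) = poly [:c, b, A:] x0] (mod int B)}"
    (is "_ \<le> card ?R")
proof -
  have Bpos: "B > 0" unfolding B_def using m by (fastforce intro!: prod_pos)
  have mB: "int (m i) dvd int B" if "i \<in> I" for i
    using that I unfolding B_def of_nat_dvd_iff by (rule dvd_prodI [rotated])
  have "coprime A (int B)" unfolding B_def using copA by (auto intro: prod_coprime_right)
  then obtain w where w: "[A * w = 1] (mod int B)" using cong_solve_coprime_int by blast
  define s where "s = - x0 - b * w"
  have "[A * (s + x0) + b = - b * (A * w) + b] (mod int B)" by (simp add: s_def algebra_simps)
  also have "[- b * (A * w) + b = - b * 1 + b] (mod int B)"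
    by (intro cong_add cong_mult w cong_refl)
  finally have s: "int B dvd A * (s + x0) + b" by (simp add: cong_0_iff)
  define t where "t T i = (if i \<in> T then x0 else s)" for T :: "'i set" and i
  have "\<exists>x\<in>{1..B}. \<forall>i\<in>I. [int x = t T i] (mod int (m i))" for T
  proof -
    \<comment> \<open>The theorem yields \<open>y\<close> in \<open>{0..<B}\<close>; shifting all residues by one moves the solution into
      \<open>{1..B}\<close>.\<close>
    obtain y where y: "y < B" "\<And>i. i \<in> I \<Longrightarrow> [y = nat ((t T i - 1) mod int B)] (mod m i)"
      using chinese_remainder_unique_nat [OF I, of m "\<lambda>i. nat ((t T i - 1) mod int B)"] m cop
      unfolding B_def by (metis gr_implies_not0)
    have "[int (Suc y) = t T i] (mod int (m i))" if i: "i \<in> I" for i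
    proof -
      have "[int y = int (nat ((t T i - 1) mod int B))] (mod int (m i))"
        using y(2) [OF i] by (simp only: cong_int_iff)
      also have "int (nat ((t T i - 1) mod int B)) = (t T i - 1) mod int B"
        using Bpos by simp
      also have "[(t T i - 1) mod int B = t T i - 1] (mod int (m i))"
        using mB [OF i] by (simp add: cong_def mod_mod_cancel)
      finally have "[int y + 1 = t T i - 1 + 1] (mod int (m i))" by (intro cong_add) auto
      thus ?thesis by (simp add: add.commute)
    qed
    thus ?thesis using y(1) by (intro bexI [of _ "Suc y"]) auto
  qed
  then obtain x where x: "\<And>T. x T \<in> {1..B}"
    and xt: "\<And>T i. i \<in> I \<Longrightarrow> [int (x T) = t T i] (mod int (m i))"
    by metis
  have "inj_on x (Pow I)"
  proof (rule inj_onI)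
    have False if T: "i \<in> T" "i \<notin> T'" "i \<in> I" and eq: "x T = x T'" for T T' i
    proof -
      have "[x0 = s] (mod int (m i))"
        using xt [OF T(3), of T] xt [OF T(3), of T'] T eq by (auto simp: t_def cong_def)
      hence "[A * (x0 + x0) + b = A * (s + x0) + b] (mod int (m i))"
        by (intro cong_add cong_mult) auto
      also have "[A * (s + x0) + b = 0] (mod int (m i))"
        using s mB [OF T(3)] by (auto simp: cong_0_iff intro: dvd_trans)
      finally have "int (m i) dvd 2 * A * x0 + b" by (simp add: cong_0_iff algebra_simps)
      hence "is_unit (int (m i))" by (rule coprime_common_divisor [OF copD [OF T(3)]]) simp
      thus False using m [OF T(3)] by simp
    qed
    thus "T = T'" if "T \<in> Pow I" "T' \<in> Pow I" "x T = x T'" for T T'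
      using that by (metis Pow_iff subsetD subsetI subset_antisym)
  qed
  moreover have "x ` Pow I \<subseteq> ?R"
  proof clarify
    fix T
    have diff: "poly [:c, b, A:] (int (x T)) - poly [:c, b, A:] x0
                 = (int (x T) - x0) * (A * (int (x T) + x0) + b)"
      by (simp add: algebra_simps)
    have "int (m i) dvd (int (x T) - x0) * (A * (int (x T) + x0) + b)" if i: "i \<in> I" for i
    proof (cases "i \<in> T")
      case True
      thus ?thesis using xt [OF i, of T] by (simp add: t_def cong_iff_dvd_diff)
    next
      case False
      hence "[int (x T) = s] (mod int (m i))" using xt [OF i, of T] by (simp add: t_def)
      hence "[A * (int (x T) + x0) + b = A * (s + x0) + b] (mod int (m i))"
        by (intro cong_add cong_mult) auto
      moreover have "int (m i) dvd A * (s + x0) + b" using s mB [OF i] by (rule dvd_trans [rotated])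
      ultimately show ?thesis by (simp add: cong_dvd_iff)
    qed
    hence "[nat \<bar>(int (x T) - x0) * (A * (int (x T) + x0) + b)\<bar> = 0] (mod B)"
      unfolding B_def
      by (intro coprime_cong_prod_nat) (use cop in \<open>auto simp: cong_0_iff dvd_nat_abs_iff\<close>)
    hence "[poly [:c, b, A:] (int (x T)) = poly [:c, b, A:] x0] (mod int B)"
      unfolding cong_iff_dvd_diff diff cong_0_iff dvd_nat_abs_iff .
    thus "x T \<in> {1..B} \<and> [poly [:c, b, A:] (int (x T)) = poly [:c, b, A:] x0] (mod int B)"
      using x by blast
  qed
  ultimately have "card (Pow I) \<le> card ?R" by (intro card_inj_on_le) auto
  thus ?thesis by (simp add: card_Pow I)
qed


section \<open>From congruences to large sieve constants\<close>

text \<open>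
  The classes are the values of \<open>\<lfloor>log \<rho> (g x)\<rfloor>\<close>, of which there are at most \<open>log \<rho> G + 1\<close>.
\<close>

lemma log_pigeonhole:
  fixes g :: "nat \<Rightarrow> real"
  assumes R: "finite R" "R \<noteq> {}" and \<rho>: "\<rho> > 1"
    and g: "\<And>x. x \<in> R \<Longrightarrow> 1 \<le> g x \<and> g x \<le> G"
  obtains S where "S \<subseteq> R" "S \<noteq> {}" "\<And>x y. x \<in> S \<Longrightarrow> y \<in> S \<Longrightarrow> g y \<le> \<rho> * g x"
    "real (card R) \<le> card S * (log \<rho> G + 1)"
proof -
  define h where "h x = nat \<lfloor>log \<rho> (g x)\<rfloor>" for x
  define K where "K = nat \<lfloor>log \<rho> G\<rfloor>"
  have log0: "0 \<le> log \<rho> (g x)" if "x \<in> R" for x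
    using g [OF that] \<rho> by (simp add: zero_le_log_cancel_iff)
  have logG: "log \<rho> (g x) \<le> log \<rho> G" if "x \<in> R" for x
    using g [OF that] \<rho> by (intro log_mono) auto
  have "0 \<le> log \<rho> G" using R log0 logG by force
  hence K: "real (card {..K}) \<le> log \<rho> G + 1" by (simp add: K_def)
  have h: "h \<in> R \<rightarrow> {..K}"
    using logG by (auto simp: h_def K_def intro!: nat_mono floor_mono)
  define S where "S y = {x \<in> R. h x = y}" for y
  obtain y where y: "card R \<le> card (S y) * card {..K}"
  proof (rule ccontr)
    assume "\<not> thesis"
    hence less: "card (S y) * card {..K} < card R" for y using that not_le by blast
    have "card R = (\<Sum>x\<in>R. 1)" by simp
    also have "\<dots> = (\<Sum>y\<in>{..K}. card (S y))"
      using h R by (subst sum.group [of R "{..K}" h, symmetric]) (auto simp: S_def)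
    finally have "card R * card {..K} = (\<Sum>y\<in>{..K}. card (S y) * card {..K})"
      by (simp only: sum_distrib_right)
    also have "\<dots> < (\<Sum>y\<in>{..K}. card R)"
      by (rule sum_strict_mono) (use less in auto)
    finally show False by simp
  qed
  show ?thesis
  proof (rule that [of "S y"])
    show "S y \<subseteq> R" by (auto simp: S_def)
    show "S y \<noteq> {}" using y R by (auto simp del: card_atMost)
    show "g v \<le> \<rho> * g u" if "u \<in> S y" "v \<in> S y" for u v
    proof -
      have uv: "u \<in> R" "v \<in> R" "h u = h v" using that by (auto simp: S_def)
      have "\<lfloor>log \<rho> (g u)\<rfloor> = \<lfloor>log \<rho> (g v)\<rfloor>"
        using uv log0 [OF uv(1)] log0 [OF uv(2)] by (simp add: h_def nat_eq_iff)
      hence "log \<rho> (g v) \<le> 1 + log \<rho> (g u)" by linarith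
      also have "\<dots> = log \<rho> (\<rho> * g u)" using \<rho> g [OF uv(1)] by (simp add: log_mult)
      finally show ?thesis using \<rho> g [OF uv(1)] g [OF uv(2)] by simp
    qed
    have "real (card R) \<le> real (card (S y)) * real (card {..K})"
      using y by (metis of_nat_le_iff of_nat_mult)
    also have "\<dots> \<le> card (S y) * (log \<rho> G + 1)" using K by (intro mult_left_mono) auto
    finally show "real (card R) \<le> card (S y) * (log \<rho> G + 1)" .
  qed
qed

text \<open>
  The number \<open>Q\<close> is not prescribed: it is the largest element of the most populated class of
  comparable values. Because its class has \<open>s\<close> elements, \<open>s \<le> Q\<close>; this is what later makes \<open>Q\<close>
  tend to infinity.
\<close>

lemma sieve_norm_large_of_value_class:
  fixes f :: "int poly" and B :: nat and r :: int
  assumes pos: "\<And>n. n \<ge> 1 \<Longrightarrow> poly f (int n) \<ge> 1"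
    and mono: "\<And>x y. 1 \<le> x \<Longrightarrow> x \<le> y \<Longrightarrow> poly f (int x) \<le> poly f (int y)"
    and B: "B > 1" and r: "coprime r (int B)"
    and R: "R \<noteq> {}" "R \<subseteq> {x \<in> {1..B}. [poly f (int x) = r] (mod int B)}"
  obtains Q s where "1 \<le> s" "s \<le> Q" "Q \<le> B"
    "real (card R) \<le> real s * (log (7/6) (poly f (int B)) + 1)"
    "real s * (of_nat Q * of_int (poly f (int Q))) / 4 \<le> sieve_norm f Q (Q * nat (poly f (int Q)))"
proof -
  have finR: "finite R" by (rule finite_subset [OF R(2)]) simp
  have bds: "1 \<le> real_of_int (poly f (int x)) \<and> real_of_int (poly f (int x)) \<le> of_int (poly f (int B))"
    if "x \<in> R" for x
    using pos [of x] mono [of x B] that R(2) by auto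
  obtain S where S: "S \<subseteq> R" "S \<noteq> {}"
    and ratio: "\<And>x y. x \<in> S \<Longrightarrow> y \<in> S \<Longrightarrow> real_of_int (poly f (int y)) \<le> 7/6 * of_int (poly f (int x))"
    and card: "real (card R) \<le> card S * (log (7/6) (poly f (int B)) + 1)"
    by (rule log_pigeonhole [OF finR R(1) _ bds, of "7/6"]) auto
  have finS: "finite S" using S(1) finR finite_subset by blast
  define Q where "Q = Max S"
  have Q: "Q \<in> S" unfolding Q_def using finS S(2) by (rule Max_in)
  have SB: "S \<subseteq> {1..B}" using S(1) R(2) by auto
  have SQ: "S \<subseteq> {1..Q}" using SB finS by (auto simp: Q_def)
  show ?thesis
  proof (rule that [of "card S" Q])
    show "1 \<le> card S" using finS S(2) by (simp add: Suc_le_eq card_gt_0_iff)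
    show "card S \<le> Q" using card_mono [OF _ SQ] by simp
    show QB: "Q \<le> B" using Q SB by auto
    show "real (card S) * (of_nat Q * of_int (poly f (int Q))) / 4
            \<le> sieve_norm f Q (Q * nat (poly f (int Q)))"
    proof (rule sieve_norm_ge_card_cong [OF SQ Q QB B r])
      fix q assume q: "q \<in> S"
      show "poly f (int q) \<ge> 1" using pos q SB by auto
      show "[poly f (int q) = r] (mod int B)" using q S(1) R(2) by auto
      show "poly f (int q) \<le> poly f (int Q)" using mono q SQ by auto
      show "6 * poly f (int Q) \<le> 7 * poly f (int q)"
        using ratio [OF q Q] by linarith
    qed
  qed (use card in auto)
qed

text \<open>
  A common divisor of two terms divides \<open>(j - i) * k! * M\<close>, but it is prime to \<open>k! * M\<close>, and
  \<open>j - i\<close> divides \<open>k!\<close>. These moduli replace primes: their size is explicit, so no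
  estimate for the distribution of primes enters.
\<close>

lemma coprime_factorial_progression:
  fixes i j k M :: nat
  assumes "i \<in> {1..k}" "j \<in> {1..k}" "i \<noteq> j"
  shows "coprime (1 + i * fact k * M) (1 + j * fact k * M)"
proof -
  have *: "coprime (1 + i * fact k * M) (1 + j * fact k * M)"
    if ij: "i < j" "j \<le> k" for i j :: nat
  proof (rule coprimeI)
    fix d assume d: "d dvd 1 + i * fact k * M" "d dvd 1 + j * fact k * M"
    have cop: "coprime d (fact k * M)"
    proof (rule coprimeI)
      fix c assume c: "c dvd d" "c dvd fact k * M"
      hence "c dvd i * fact k * M" by (metis dvd_mult mult.assoc)
      moreover have "c dvd 1 + i * fact k * M" using c(1) d(1) by (rule dvd_trans)
      ultimately show "is_unit c" using dvd_add_left_iff by blast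
    qed
    have "d dvd (1 + j * fact k * M) - (1 + i * fact k * M)" using d by (intro dvd_diff_nat)
    also have "\<dots> = (j - i) * (fact k * M)" by (simp add: diff_mult_distrib mult.assoc)
    finally have "d dvd j - i" using cop by (simp add: coprime_dvd_mult_left_iff)
    also have "j - i dvd fact k" using ij by (intro dvd_fact) auto
    also have "fact k dvd fact k * M" by simp
    finally show "is_unit d" using cop coprime_common_divisor [of d "fact k * M" d] by simp
  qed
  show ?thesis
    using * [of i j] * [of j i] assms by (cases "i < j") (auto simp: coprime_commute)
qed

text \<open>
  The parameter \<open>M\<close> of the progression collects everything to which \<open>B\<close> has to be prime: the
  leading coefficient and \<open>f' x0\<close>, for the two roots modulo each factor, and \<open>f x0\<close>, which must be
  invertible modulo \<open>B\<close>. Each factor is at most \<open>(1 + M) * k ^ (k + 1)\<close>, hence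
  \<open>ln B = O(k^3)\<close>.
\<close>

lemma quadratic_rich_value_class:
  fixes f :: "int poly" and x0 :: int
  assumes deg: "degree f = 2" and f0: "poly f x0 \<noteq> 0" and f'0: "poly (pderiv f) x0 \<noteq> 0"
    and pos: "\<forall>n\<ge>1. poly f (int n) \<ge> 1"
  shows "\<exists>C\<ge>1. \<forall>k\<ge>1. \<exists>B>1. coprime (poly f x0) (int B)
       \<and> 2 ^ k \<le> card {x \<in> {1..B}. [poly f (int x) = poly f x0] (mod int B)}
       \<and> ln (of_int (poly f (int B))) \<le> C * real k ^ 3"
proof -
  define A b c where "A = coeff f 2" and "b = coeff f 1" and "c = coeff f 0"
  have f: "f = [:c, b, A:]"
  proof (rule poly_eqI)
    fix n show "coeff f n = coeff [:c, b, A:] n"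
      using deg by (cases "n \<le> 2")
        (auto simp: A_def b_def c_def coeff_pCons coeff_eq_0 le_Suc_eq numeral_2_eq_2 split: nat.split)
  qed
  have A: "A \<noteq> 0" using deg unfolding A_def by (metis degree_0 leading_coeff_0_iff zero_neq_numeral)
  have D: "2 * A * x0 + b \<noteq> 0" using f'0 by (simp add: f pderiv_pCons algebra_simps)
  define M where "M = nat \<bar>A * (2 * A * x0 + b) * poly f x0\<bar>"
  have M: "M > 0" using A D f0 by (simp add: M_def)
  define C0 where "C0 = \<bar>real_of_int A\<bar> + \<bar>real_of_int b\<bar> + \<bar>real_of_int c\<bar>"
  have C0: "C0 \<ge> 1" using A unfolding C0_def by linarith
  have lnM: "ln (1 + real M) \<ge> 0" by simp
  define C where "C = ln C0 + 2 * ln (1 + real M) + 4"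
  show ?thesis
  proof (intro exI [of _ C] conjI allI impI)
    show "C \<ge> 1" using C0 lnM ln_ge_zero [OF C0] unfolding C_def by linarith
    fix k :: nat assume k: "k \<ge> 1"
    define m where "m i = 1 + i * fact k * M" for i
    define B where "B = (\<Prod>i\<in>{1..k}. m i)"
    have m1: "m i > 1" if "i \<in> {1..k}" for i using that M by (simp add: m_def)
    have cop: "coprime y (int (m i))" if y: "y dvd A * (2 * A * x0 + b) * poly f x0" for y i
    proof (rule coprimeI)
      fix d assume d: "d dvd y" "d dvd int (m i)"
      have "d dvd int M" using dvd_trans [OF d(1) y] by (simp add: M_def)
      hence "d dvd int (i * fact k) * int M" by (rule dvd_mult)
      hence "d dvd int (m i) - int (i * fact k) * int M" using d(2) by (intro dvd_diff)
      thus "is_unit d" by (simp add: m_def)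
    qed
    have m_le: "real (m i) \<le> (1 + M) * real k ^ (k + 1)" if i: "i \<in> {1..k}" for i
    proof -
      have "i * fact k * M \<le> k * k ^ k * M"
        using i fact_le_power [of k, where 'a = nat] by (intro mult_mono) auto
      moreover have "1 \<le> k * k ^ k" using k by simp
      ultimately have "m i \<le> k * k ^ k + k * k ^ k * M" unfolding m_def by linarith
      hence "m i \<le> (1 + M) * k ^ (k + 1)" by (simp add: algebra_simps)
      thus ?thesis by (metis of_nat_le_iff of_nat_mult of_nat_power)
    qed
    have "real B \<le> (\<Prod>i\<in>{1..k}. (1 + M) * real k ^ (k + 1))"
      unfolding B_def of_nat_prod by (rule prod_mono) (use m_le in auto)
    hence B_le: "real B \<le> ((1 + M) * real k ^ (k + 1)) ^ k" by simp
    have B_pos: "B > 0" unfolding B_def by (intro prod_pos) (auto simp: m_def)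
    have "m 1 dvd B" unfolding B_def using k by (intro dvd_prodI) auto
    hence "m 1 \<le> B" using B_pos by (rule dvd_imp_le)
    hence B1: "B > 1" using m1 [of 1] k by simp
    have "ln (real k) \<le> k" using ln_le_minus_one [of "real k"] k by simp
    have lnB_le: "ln (real B) \<le> k * (ln (1 + real M) + (k + 1) * real k)"
    proof -
      have "ln (real B) \<le> ln (((1 + M) * real k ^ (k + 1)) ^ k)"
        using B_le B_pos by simp
      also have "\<dots> = k * (ln (1 + real M) + (k + 1) * ln (real k))"
        using k by (simp add: ln_realpow ln_mult del: power_Suc)
      also have "\<dots> \<le> k * (ln (1 + real M) + (k + 1) * real k)"
        using \<open>ln (real k) \<le> k\<close> by (intro mult_left_mono add_left_mono) auto
      finally show ?thesis .
    qed
    have "of_int (poly f (int B)) \<le> C0 * real B ^ 2"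
    proof -
      have B1': "1 \<le> real B" using B_pos by linarith
      have "real_of_int (poly f (int B)) = real_of_int c * 1 + b * real B + A * real B ^ 2"
        by (simp add: f power2_eq_square algebra_simps)
      also have "\<dots> \<le> \<bar>real_of_int c\<bar> * real B ^ 2 + \<bar>real_of_int b\<bar> * real B ^ 2 + \<bar>real_of_int A\<bar> * real B ^ 2"
        using B1' self_le_power [OF B1', of 2] one_le_power [OF B1', of 2]
        by (intro add_mono mult_mono abs_ge_self) auto
      finally show ?thesis by (simp add: C0_def algebra_simps)
    qed
    hence "ln (of_int (poly f (int B))) \<le> ln (C0 * real B ^ 2)"
      using spec [OF pos, of B] B1 C0 by (subst ln_le_cancel_iff) auto
    also have "\<dots> = ln C0 + 2 * ln (real B)"
      using C0 B_pos by (simp add: ln_mult ln_realpow)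
    also have "\<dots> \<le> ln C0 + 2 * (k * (ln (1 + real M) + (k + 1) * real k))"
      using lnB_le by simp
    also have "\<dots> = ln C0 * 1 + 2 * ln (1 + real M) * real k + 2 * real k ^ 3 + 2 * real k ^ 2"
      by (simp add: power2_eq_square power3_eq_cube algebra_simps)
    also have "\<dots> \<le> ln C0 * real k ^ 3 + 2 * ln (1 + real M) * real k ^ 3 + 2 * real k ^ 3 + 2 * real k ^ 3"
    proof -
      have k1: "1 \<le> real k" using k by simp
      show ?thesis
        using k1 lnM ln_ge_zero [OF C0] self_le_power [OF k1, of 3] one_le_power [OF k1, of 3]
          power_increasing [of 2 3 "real k"]
        by (intro add_mono mult_left_mono) auto
    qed
    also have "\<dots> = C * real k ^ 3" by (simp add: C_def algebra_simps)
    finally have lnB: "ln (of_int (poly f (int B))) \<le> C * real k ^ 3" .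
    have "2 ^ card {1..k} \<le> card {x \<in> {1..B}. [poly f (int x) = poly f x0] (mod int B)}"
      unfolding f B_def
    proof (rule card_quadratic_cong_ge)
      show "coprime (m i) (m j)" if "i \<in> {1..k}" "j \<in> {1..k}" "i \<noteq> j" for i j
        unfolding m_def using that by (rule coprime_factorial_progression)
    qed (use m1 cop in auto)
    moreover have "coprime (poly f x0) (int B)"
      unfolding B_def of_nat_prod by (intro prod_coprime_right cop) auto
    ultimately show "\<exists>B>1. coprime (poly f x0) (int B)
       \<and> 2 ^ k \<le> card {x \<in> {1..B}. [poly f (int x) = poly f x0] (mod int B)}
       \<and> ln (of_int (poly f (int B))) \<le> C * real k ^ 3"
      using B1 lnB by auto
  qed
qed

section \<open>The lower limit\<close>

theorem theorem1p3:
  fixes f :: "int poly" and J :: real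
  assumes "degree f = 2"
    and "poly f ` {1..} \<subseteq> {1..}"
    and "strict_mono_on {1..} (poly f)"
    and "J > 0"
  shows "liminf (\<lambda>Q::nat. ereal
           (ln (of_int (poly f (int Q))) powr J * (of_nat Q * of_int (poly f (int Q)))
             / sieve_norm f Q (Q * nat (poly f (int Q))))) = 0"
proof -
  define X where "X Q = ln (of_int (poly f (int Q))) powr J * (of_nat Q * of_int (poly f (int Q)))
             / sieve_norm f Q (Q * nat (poly f (int Q)))" for Q :: nat
  have pos: "poly f (int n) \<ge> 1" if "n \<ge> 1" for n
    using assms(2) that by (auto simp: image_subset_iff)
  have mono: "poly f (int x) \<le> poly f (int y)" if "1 \<le> x" "x \<le> y" for x y
    using strict_mono_on_leD [OF assms(3)] that by simp
  have X0: "X Q \<ge> 0" if Q: "Q \<ge> 1" for Q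
    unfolding X_def using Q pos [OF Q] by (intro divide_nonneg_nonneg sieve_norm_nonneg mult_nonneg_nonneg) auto
  have f0: "poly f 2 \<noteq> 0" using pos [of 2] by simp
  have f'0: "poly (pderiv f) 2 \<noteq> 0"
  proof -
    have "f = [:coeff f 0, coeff f 1, coeff f 2:]"
      using assms(1)
      by (intro poly_eqI) (auto simp: coeff_pCons coeff_eq_0 numeral_2_eq_2 split: nat.split)
    then obtain A b c where f: "f = [:c, b, A:]" by blast
    have "poly f 1 < poly f 3" using assms(3) by (auto simp: strict_mono_on_def)
    thus ?thesis by (simp add: f pderiv_pCons)
  qed
  obtain C :: real where C: "C \<ge> 1" and rich: "\<forall>k\<ge>1. \<exists>B>1. coprime (poly f 2) (int B)
       \<and> 2 ^ k \<le> card {x \<in> {1..B}. [poly f (int x) = poly f 2] (mod int B)}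
       \<and> ln (of_int (poly f (int B))) \<le> C * real k ^ 3"
    using quadratic_rich_value_class [OF assms(1) f0 f'0] pos by blast
  define c where "c = ln (7/6 :: real)"
  have c: "c > 0" by (simp add: c_def)
  \<comment> \<open>\<open>D k\<close> bounds the number of classes in the pigeonhole argument.\<close>
  define D where "D k = C * real k ^ 3 / c + 1" for k :: nat
  \<comment> \<open>For the modulus belonging to \<open>k\<close> the cluster has \<open>s \<ge> 2 ^ k / D k\<close> elements, and
    \<open>X Q \<le> 4 * (C * k^3) powr J / s\<close>; so a single large \<open>k\<close> makes \<open>Q\<close> large and \<open>X Q\<close> small.\<close>
  have small: "\<exists>Q\<ge>n. X Q < \<epsilon>" if \<epsilon>: "\<epsilon> > 0" for \<epsilon> n
  proof -
    have "(\<lambda>k. 4 * (C * real k ^ 3) powr J * D k / 2 ^ k) \<longlonglongrightarrow> 0"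
      unfolding D_def using C c assms(4) by real_asymp
    hence "\<forall>\<^sub>F k in sequentially. 4 * (C * real k ^ 3) powr J * D k / 2 ^ k < \<epsilon>"
      using \<epsilon> by (rule order_tendstoD)
    moreover have "(\<lambda>k. real n * D k / 2 ^ k) \<longlonglongrightarrow> 0"
      unfolding D_def using C c by real_asymp
    hence "\<forall>\<^sub>F k in sequentially. real n * D k / 2 ^ k < 1"
      by (rule order_tendstoD) simp
    ultimately have "\<forall>\<^sub>F k in sequentially. k \<ge> 1 \<and> real n * D k / 2 ^ k < 1
        \<and> 4 * (C * real k ^ 3) powr J * D k / 2 ^ k < \<epsilon>"
      using eventually_ge_at_top [of 1] by eventually_elim auto
    then obtain k :: nat where k: "k \<ge> 1" and kn: "real n * D k / 2 ^ k < 1"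
      and k\<epsilon>: "4 * (C * real k ^ 3) powr J * D k / 2 ^ k < \<epsilon>"
      using eventually_happens' [OF sequentially_bot] by blast
    have D: "D k > 0" using C c by (simp add: D_def add_nonneg_pos)
    obtain B :: nat where B: "B > 1" "coprime (poly f 2) (int B)"
      and R: "2 ^ k \<le> card {x \<in> {1..B}. [poly f (int x) = poly f 2] (mod int B)}" (is "_ \<le> card ?R")
      and lnB: "ln (of_int (poly f (int B))) \<le> C * real k ^ 3"
      using rich k by blast
    have "?R \<noteq> {}" using R by (metis card.empty not_le zero_less_numeral zero_less_power)
    then obtain Q s where s: "1 \<le> s" "s \<le> Q" "Q \<le> B"
      and card: "real (card ?R) \<le> real s * (log (7/6) (poly f (int B)) + 1)"
      and norm: "real s * (of_nat Q * of_int (poly f (int Q))) / 4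
                   \<le> sieve_norm f Q (Q * nat (poly f (int Q)))"
      using sieve_norm_large_of_value_class [OF pos mono B _ order_refl] by blast
    have "2 ^ k \<le> real (card ?R)" using R by (metis of_nat_le_iff of_nat_numeral of_nat_power)
    also note card
    also have "real s * (log (7/6) (poly f (int B)) + 1) \<le> real s * D k"
      using lnB c by (intro mult_left_mono) (auto simp: D_def log_def c_def divide_right_mono)
    finally have s_ge: "2 ^ k \<le> real s * D k" .
    have "real n * D k < 2 ^ k" using kn by simp
    also note s_ge
    finally have "n < s" using D by simp
    hence "n \<le> Q" using s by simp
    moreover have "X Q < \<epsilon>"
    proof -
      define N where "N = real Q * of_int (poly f (int Q))"
      have fQ: "poly f (int Q) \<ge> 1" using pos s by simp
      have N: "N > 0" using fQ s by (simp add: N_def)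
      have "ln (real_of_int (poly f (int Q))) \<le> ln (of_int (poly f (int B)))"
        using fQ mono [of Q B] s by simp
      hence lnQ: "ln (real_of_int (poly f (int Q))) \<le> C * real k ^ 3" using lnB by linarith
      have "X Q \<le> (C * real k ^ 3) powr J * N / (real s * N / 4)"
        unfolding X_def N_def [symmetric] using norm lnQ fQ N s assms(4)
        by (intro frac_le mult_right_mono powr_mono2) (auto simp: N_def)
      also have "\<dots> = 4 * (C * real k ^ 3) powr J * (1 / s)" using N by simp
      also have "\<dots> \<le> 4 * (C * real k ^ 3) powr J * (D k / 2 ^ k)"
        using s_ge s by (intro mult_left_mono) (auto simp: field_simps)
      finally show ?thesis using k\<epsilon> by simp
    qed
    ultimately show ?thesis by blast
  qed
  have "liminf (\<lambda>Q. ereal (X Q)) \<le> 0"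
  proof (rule ccontr)
    assume "\<not> ?thesis"
    then obtain \<epsilon> where \<epsilon>: "0 < ereal \<epsilon>" "ereal \<epsilon> < liminf (\<lambda>Q. ereal (X Q))"
      using ereal_dense2 by (metis not_le)
    from less_LiminfD [OF \<epsilon>(2)] obtain n where n: "\<And>Q. Q \<ge> n \<Longrightarrow> \<epsilon> < X Q"
      by (auto simp: eventually_sequentially)
    obtain Q where "Q \<ge> n" "X Q < \<epsilon>" using small [of \<epsilon> n] \<epsilon>(1) by auto
    thus False using n [of Q] by linarith
  qed
  moreover have "0 \<le> liminf (\<lambda>Q. ereal (X Q))"
    by (rule Liminf_bounded)
      (use X0 in \<open>auto simp: eventually_sequentially intro!: exI [of _ 1]\<close>)
  ultimately show ?thesis unfolding X_def by (rule antisym)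
qed

end
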